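(* Let $c_5(n)$ be defined by $\frac{1}{\Psi(-q^5,q)} = \sum_{n=0}^\infty c_5(n) q^n$. Then for all integers $n \ge 0$, $$c_5(32n+31) \equiv 0 \pmod{4}.$$
   Context: The false theta function is the formal power series in $q$ (for $a,b$ equal to signed powers of $q$) given by $$\Psi(a,b) := \sum_{n=0}^\infty a^{\binom{n+1}{2}} b^{\binom{n}{2}} - \sum_{n=-\infty}^{-1} a^{\binom{n+1}{2}} b^{\binom{n}{2}},$$ where for every integer $n$, $\binom{n+1}{2} = n(n+1)/2$ and $\binom{n}{2} = n(n-1)/2$. The series $\Psi(-q^5,q)$ has constant term $1$, so its reciprocal is a power series with integer coefficients. *)

theory Defs
  imports "HOL-Analysis.Infinite_Sum" "HOL-Number_Theory.Cong"
begin

unbundle fps_syntax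

text \<open>
  Infinite sums of formal power series are taken in the topology of coefficientwise
  stabilisation. The exponents are nonnegative for every integer \<open>n\<close>, and the divisions
  by 2 are exact.
\<close>

definition false_theta :: "int fps \<Rightarrow> int fps \<Rightarrow> int fps" where
  "false_theta a b =
     (\<Sum>\<^sub>\<infinity>n\<in>{0::int..}. a ^ nat (n * (n + 1) div 2) * b ^ nat (n * (n - 1) div 2))
   - (\<Sum>\<^sub>\<infinity>n\<in>{..-1::int}. a ^ nat (n * (n + 1) div 2) * b ^ nat (n * (n - 1) div 2))"

text \<open>
  The type \<open>int\<close> has no multiplicative \<open>inverse\<close>, so the reciprocal is formed from the inverse
  \<open>1\<close> of the constant term; lemma \<open>false_theta_mult_c5\<close> shows that it is the reciprocal.
\<close>

definition c5 :: "nat \<Rightarrow> int" where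
  "c5 n = fps_right_inverse (false_theta (- (fps_X ^ 5)) fps_X) 1 $ n"

lemma false_theta_term_nth:
  fixes n :: int
  shows "((- (fps_X ^ 5) :: int fps) ^ nat (n * (n + 1) div 2)
            * fps_X ^ nat (n * (n - 1) div 2)) $ k
       = (if int k = 3 * n\<^sup>2 + 2 * n then (-1) ^ nat (n * (n + 1) div 2) else 0)"
proof -
  define u where "u = nat (n * (n + 1) div 2)"
  define v where "v = nat (n * (n - 1) div 2)"
  have nonneg: "n * (n + 1) \<ge> 0" "n * (n - 1) \<ge> 0"
    by (auto simp: zero_le_mult_iff)
  have "2 * int u = n * (n + 1)" "2 * int v = n * (n - 1)"
    using nonneg by (simp_all add: u_def v_def)
  hence e: "int (5 * u + v) = 3 * n\<^sup>2 + 2 * n"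
    by (simp add: power2_eq_square algebra_simps)
  have "(- (fps_X ^ 5) :: int fps) ^ u * fps_X ^ v = fps_const ((-1) ^ u) * fps_X ^ (5 * u + v)"
    by (subst power_minus) (simp add: power_mult power_add mult.assoc
        flip: fps_const_power fps_const_neg)
  hence "((- (fps_X ^ 5) :: int fps) ^ u * fps_X ^ v) $ k
         = (if k = 5 * u + v then (-1) ^ u else 0)"
    by (simp add: fps_X_power_nth)
  moreover have "k = 5 * u + v \<longleftrightarrow> int k = 3 * n\<^sup>2 + 2 * n"
    using e by linarith
  ultimately show ?thesis
    by (simp add: u_def v_def)
qed

lemma abs_le_exponent: "\<bar>n\<bar> \<le> 3 * n\<^sup>2 + 2 * (n :: int)"
proof -
  have "\<bar>n\<bar> \<le> n\<^sup>2"
    using self_le_power[of "\<bar>n\<bar>" 2] by (cases "n = 0") auto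
  thus ?thesis by linarith
qed

lemma false_theta_has_sum:
  fixes A :: "int set"
  shows "((\<lambda>n. (- (fps_X ^ 5) :: int fps) ^ nat (n * (n + 1) div 2)
                 * fps_X ^ nat (n * (n - 1) div 2))
          has_sum Abs_fps (\<lambda>k. \<Sum>n | n \<in> A \<and> int k = 3 * n\<^sup>2 + 2 * n.
                                (-1) ^ nat (n * (n + 1) div 2))) A"
proof (rule has_sum_fpsI)
  fix k :: nat
  have eq: "{n \<in> A. ((- (fps_X ^ 5) :: int fps) ^ nat (n * (n + 1) div 2)
              * fps_X ^ nat (n * (n - 1) div 2)) $ k \<noteq> 0}
        = {n \<in> A. int k = 3 * n\<^sup>2 + 2 * n}"
    by (auto simp: false_theta_term_nth)
  have "{n \<in> A. int k = 3 * n\<^sup>2 + 2 * n} \<subseteq> {- int k..int k}"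
  proof
    fix n assume "n \<in> {n \<in> A. int k = 3 * n\<^sup>2 + 2 * n}"
    thus "n \<in> {- int k..int k}" using abs_le_exponent[of n] by auto
  qed
  thus "finite {n \<in> A. ((- (fps_X ^ 5) :: int fps) ^ nat (n * (n + 1) div 2)
              * fps_X ^ nat (n * (n - 1) div 2)) $ k \<noteq> 0}"
    unfolding eq using finite_subset by blast
  show "Abs_fps (\<lambda>k. \<Sum>n | n \<in> A \<and> int k = 3 * n\<^sup>2 + 2 * n. (-1) ^ nat (n * (n + 1) div 2)) $ k
     = (\<Sum>n | n \<in> A \<and> ((- (fps_X ^ 5) :: int fps) ^ nat (n * (n + 1) div 2)
              * fps_X ^ nat (n * (n - 1) div 2)) $ k \<noteq> 0.
          ((- (fps_X ^ 5) :: int fps) ^ nat (n * (n + 1) div 2)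
              * fps_X ^ nat (n * (n - 1) div 2)) $ k)"
    unfolding eq by (simp add: false_theta_term_nth)
qed

lemma false_theta_nth_0: "false_theta (- (fps_X ^ 5)) fps_X $ 0 = 1"
proof -
  have iff: "0 = 3 * n\<^sup>2 + 2 * n \<longleftrightarrow> n = 0" for n :: int
    using abs_le_exponent[of n] by auto
  have "{n. 0 \<le> n \<and> n = 0} = {0 :: int}" "{n. n \<le> - 1 \<and> n = 0} = ({} :: int set)"
    by auto
  thus ?thesis
    unfolding false_theta_def
    by (subst (1 2) infsumI[OF false_theta_has_sum]) (simp add: iff)
qed

lemma false_theta_mult_c5: "false_theta (- (fps_X ^ 5)) fps_X * Abs_fps c5 = 1"
proof -
  have "Abs_fps c5 = fps_right_inverse (false_theta (- (fps_X ^ 5)) fps_X) 1"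
    by (rule fps_ext) (simp add: c5_def)
  thus ?thesis
    by (simp add: fps_right_inverse false_theta_nth_0)
qed

end

theory Submission
  imports Defs
begin

text \<open>
  Write \<open>C\<close> for the reciprocal. If \<open>F * C = G\<close>, splitting into even and odd parts and eliminating
  the even part of \<open>C\<close> gives \<open>(e\<^sup>2 - X o\<^sup>2) C' = e g\<^sub>o - o g\<^sub>e\<close> for the series \<open>C'\<close> of odd-indexed
  coefficients. Starting from \<open>F = \<Psi>\<close>, \<open>G = 1\<close>, two steps give \<open>A^4 - X B^4\<close> and \<open>- B^3\<close> with false
  theta functions \<open>A\<close>, \<open>B\<close>. Let \<open>P\<close> and \<open>T\<close> be the sums of \<open>q^(3n\<^sup>2+n)\<close> and \<open>q^(3n\<^sup>2+2n)\<close> over all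
  integers \<open>n\<close>; then \<open>A\<close>, \<open>B\<close> agree with \<open>P\<close>, \<open>T\<close> modulo 2. Since \<open>F(q)^4\<close> is congruent to
  \<open>F(q\<^sup>2)\<^sup>2\<close> modulo 4, further steps keep reproducing the denominator \<open>P^4 - X T^4\<close> modulo 4. After
  two of them all contributions of the signs cancel and the coefficients \<open>c\<^sub>5(16n+15)\<close> are, modulo 4,
  those of twice a product of three even series.
\<close>

subsection \<open>Bisection of power series\<close>

definition even_part :: "'a::comm_ring_1 fps \<Rightarrow> 'a fps" where
  "even_part F = Abs_fps (\<lambda>n. F $ (2 * n))"

definition odd_part :: "'a::comm_ring_1 fps \<Rightarrow> 'a fps" where
  "odd_part F = Abs_fps (\<lambda>n. F $ (2 * n + 1))"

lemma even_part_nth [simp]: "even_part F $ n = F $ (2 * n)"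
  by (simp add: even_part_def)

lemma odd_part_nth [simp]: "odd_part F $ n = F $ Suc (2 * n)"
  by (simp add: odd_part_def)

lemma bisect_linear [simp]:
  "even_part (F + G) = even_part F + even_part G" "odd_part (F + G) = odd_part F + odd_part G"
  "even_part (F - G) = even_part F - even_part G" "odd_part (F - G) = odd_part F - odd_part G"
  "even_part (- F) = - even_part F" "odd_part (- F) = - odd_part F"
  by (simp_all add: fps_eq_iff)

lemma bisect_X_mult [simp]:
  "even_part (fps_X * F) = fps_X * odd_part F" "odd_part (fps_X * F) = even_part F"
  by (auto simp: fps_eq_iff fps_X_mult_nth Suc_diff_Suc numeral_2_eq_2
      intro!: arg_cong[of _ _ "fps_nth F"])

lemma bisect_X [simp]: "even_part fps_X = 0" "odd_part fps_X = 1"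
  by (auto simp: fps_eq_iff fps_X_def)

lemma bisect_numeral [simp]:
  "even_part (numeral k) = numeral k" "odd_part (numeral k) = 0"
  "even_part 1 = 1" "odd_part 1 = 0"
  by (simp_all add: fps_eq_iff numeral_fps_const)

lemma bisect_mult [simp]:
  "even_part (F * G) = even_part F * even_part G + fps_X * (odd_part F * odd_part G)"
  "odd_part (F * G) = even_part F * odd_part G + odd_part F * even_part G"
proof -
  have split: "(\<Sum>i=0..2*n. h i) = (\<Sum>i=0..n. h (2*i)) + (\<Sum>i<n. h (2*i+1))"
    for n and h :: "nat \<Rightarrow> 'a"
    by (induction n) (simp_all add: algebra_simps)
  have split': "(\<Sum>i=0..Suc(2*n). h i) = (\<Sum>i=0..n. h (2*i)) + (\<Sum>i=0..n. h (2*i+1))"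
    for n and h :: "nat \<Rightarrow> 'a"
    by (induction n) (simp_all add: algebra_simps)
  show "even_part (F * G) = even_part F * even_part G + fps_X * (odd_part F * odd_part G)"
  proof (rule fps_ext)
    fix n
    have "(\<Sum>i<n. F $ (2*i+1) * G $ (2*n - (2*i+1))) = (fps_X * (odd_part F * odd_part G)) $ n"
    proof (cases n)
      case (Suc m)
      have "F $ (2*i+1) * G $ (2*n - (2*i+1)) = F $ Suc (2*i) * G $ Suc (2*(m-i))" if "i \<le> m" for i
        using that by (simp add: Suc diff_mult_distrib2 Suc_diff_le)
      then show ?thesis
        by (subst fps_X_mult_nth) (simp add: Suc fps_mult_nth atLeast0AtMost lessThan_Suc_atMost)
    qed simp
    then show "even_part (F * G) $ n
        = (even_part F * even_part G + fps_X * (odd_part F * odd_part G)) $ n"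
      by (simp add: fps_mult_nth split diff_mult_distrib2)
  qed
  show "odd_part (F * G) = even_part F * odd_part G + odd_part F * even_part G"
  proof (rule fps_ext)
    fix n
    have "F $ (2*i) * G $ (Suc (2*n) - 2*i) = F $ (2*i) * G $ Suc (2*(n-i))" if "i \<le> n" for i
      using that by (simp add: Suc_diff_le diff_mult_distrib2)
    moreover have "odd_part (F * G) $ n
        = (\<Sum>i=0..n. F $ (2*i) * G $ (Suc (2*n) - 2*i))
        + (\<Sum>i=0..n. F $ (2*i+1) * G $ (Suc (2*n) - (2*i+1)))"
      by (simp only: odd_part_nth fps_mult_nth split')
    ultimately show "odd_part (F * G) $ n
        = (even_part F * odd_part G + odd_part F * even_part G) $ n"
      by (simp add: fps_mult_nth diff_mult_distrib2)
  qed
qed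

text \<open>Cramer's rule: the two parts of \<open>F * C = G\<close> are linear equations in
  \<open>even_part C\<close> and \<open>odd_part C\<close>, and the factor on the left is the
  determinant of this system.\<close>

lemma odd_part_eliminate:
  assumes "F * C = G"
  shows "((even_part F)\<^sup>2 - fps_X * (odd_part F)\<^sup>2) * odd_part C
       = even_part F * odd_part G - odd_part F * even_part G"
  unfolding assms[symmetric] by (simp add: algebra_simps power2_eq_square)

lemma bisect_numeral_dvd:
  assumes "numeral k dvd F"
  shows "numeral k dvd even_part F" "numeral k dvd odd_part F"
  using assms by (auto elim!: dvdE)

lemma numeral_dvd_fps_iff:
  "numeral k dvd (F :: 'a::comm_ring_1 fps) \<longleftrightarrow> (\<forall>n. numeral k dvd F $ n)"
proof
  assume "\<forall>n. numeral k dvd F $ n"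
  then obtain h where "\<And>n. F $ n = numeral k * h n"
    unfolding dvd_def by metis
  then have "F = numeral k * Abs_fps h"
    by (simp add: fps_eq_iff numeral_fps_const)
  then show "numeral k dvd F" by simp
qed (auto elim!: dvdE simp: numeral_fps_const)

subsection \<open>Squares modulo 2 and fourth powers modulo 4\<close>

text \<open>This carries the Frobenius congruence of F(q)^2 with F(q^2) modulo 2. The induction
  needs all \<open>F\<close> at once, since the even part of a square is built from the squares of
  both parts.\<close>

lemma even_part_square_mod_2:
  "(2 :: int fps) dvd even_part (F\<^sup>2) - F"
proof -
  have "2 dvd (F\<^sup>2) $ (2 * n) - F $ n" for n
  proof (induction n arbitrary: F rule: less_induct)
    case (less n)
    have odd: "2 dvd (G\<^sup>2) $ Suc (2 * m)" for G :: "int fps" and m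
    proof -
      have "(2 :: int fps) dvd odd_part (G\<^sup>2)"
        by (simp add: power2_eq_square mult.commute flip: mult_2)
      then show ?thesis
        unfolding numeral_dvd_fps_iff odd_part_nth by blast
    qed
    have "(F\<^sup>2) $ (2 * n) = even_part (F\<^sup>2) $ n" by simp
    also have "even_part (F\<^sup>2) = (even_part F)\<^sup>2 + fps_X * (odd_part F)\<^sup>2"
      by (simp add: power2_eq_square)
    finally have eq: "(F\<^sup>2) $ (2 * n)
        = ((even_part F)\<^sup>2) $ n + (if n = 0 then 0 else ((odd_part F)\<^sup>2) $ (n - 1))"
      by (simp add: fps_X_mult_nth)
    show ?case
    proof (cases "n = 0")
      case True
      then show ?thesis by (simp add: power2_eq_square)
    next
      case n: False
      show ?thesis
      \<comment> \<open>Of the two squares in \<open>eq\<close>, one is read at an odd index, where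
        its coefficient is even. The other is covered by the induction hypothesis for that part of
        \<open>F\<close>.\<close>
      proof (cases "even n")
        case True
        then obtain m where m: "n = 2 * m" by blast
        then have "m < n" "n - 1 = Suc (2 * (m - 1))" using n by auto
        then show ?thesis
          using less[of m "even_part F"] odd[of "odd_part F" "m - 1"] n m eq
          by (auto simp: algebra_simps)
      next
        case False
        then obtain m where m: "n = 2 * m + 1" by (rule oddE)
        then show ?thesis
          using less[of m "odd_part F"] odd[of "even_part F" m] n eq
          by (auto simp: algebra_simps)
      qed
    qed
  qed
  then show ?thesis unfolding numeral_dvd_fps_iff by simp
qed

lemma square_mod_4:
  assumes "2 dvd F - (G :: int fps)"
  shows "4 dvd F\<^sup>2 - G\<^sup>2"
proof -
  obtain H where H: "F = G + 2 * H"
    using assms by (metis diff_eq_eq add.commute dvdE)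
  have "F\<^sup>2 - G\<^sup>2 = 4 * (G * H + H\<^sup>2)"
    unfolding H by (simp add: algebra_simps power2_eq_square)
  then show ?thesis by simp
qed

text \<open>The odd part of \<open>F\<^sup>2\<close> is twice a series, so squaring once more
  removes it modulo 4; squaring also lifts the Frobenius congruence from modulus 2 to modulus
  4.\<close>

lemma bisect_power4_mod_4:
  "(4 :: int fps) dvd even_part (F ^ 4) - F\<^sup>2" "(4 :: int fps) dvd odd_part (F ^ 4)"
proof -
  define e where "e = even_part (F\<^sup>2)"
  define g where "g = even_part F * odd_part F"
  have o: "odd_part (F\<^sup>2) = 2 * g"
    by (simp add: g_def power2_eq_square algebra_simps)
  have F4: "F ^ 4 = F\<^sup>2 * F\<^sup>2" by (simp flip: power_add)
  have "even_part (F ^ 4) - F\<^sup>2 = (e\<^sup>2 - F\<^sup>2) + 4 * (fps_X * g\<^sup>2)"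
    unfolding F4 bisect_mult(1) o e_def[symmetric] by (simp add: power2_eq_square algebra_simps)
  moreover have "4 dvd e\<^sup>2 - F\<^sup>2"
    unfolding e_def by (intro square_mod_4 even_part_square_mod_2)
  ultimately show "4 dvd even_part (F ^ 4) - F\<^sup>2"
    by (metis dvd_add dvd_triv_left)
  have "odd_part (F ^ 4) = 4 * (e * g)"
    unfolding F4 bisect_mult(2) o e_def[symmetric] by (simp add: algebra_simps)
  then show "4 dvd odd_part (F ^ 4)" by simp
qed

text \<open>The factor \<open>fps_X\<close> swaps the parts of \<open>B ^ 4\<close>, so
  \<open>A\<close> governs the even part and \<open>B\<close> the odd part, each through its residue
  modulo 2 only.\<close>

lemma bisect_denominator_mod_4:
  fixes A B P T :: "int fps"
  assumes "2 dvd A - P" "2 dvd B - T"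
  shows "4 dvd even_part (A ^ 4 - fps_X * B ^ 4) - P\<^sup>2"
    and "4 dvd odd_part (A ^ 4 - fps_X * B ^ 4) + T\<^sup>2"
proof -
  have "even_part (A ^ 4 - fps_X * B ^ 4) - P\<^sup>2
      = (even_part (A ^ 4) - A\<^sup>2) + (A\<^sup>2 - P\<^sup>2) - fps_X * odd_part (B ^ 4)"
    by (simp del: bisect_mult)
  then show "4 dvd even_part (A ^ 4 - fps_X * B ^ 4) - P\<^sup>2"
    using bisect_power4_mod_4[of A] bisect_power4_mod_4(2)[of B] square_mod_4[OF assms(1)]
    by (metis dvd_add dvd_diff dvd_mult)
  have "odd_part (A ^ 4 - fps_X * B ^ 4) + T\<^sup>2
      = odd_part (A ^ 4) - (even_part (B ^ 4) - B\<^sup>2) - (B\<^sup>2 - T\<^sup>2)"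
    by (simp del: bisect_mult)
  then show "4 dvd odd_part (A ^ 4 - fps_X * B ^ 4) + T\<^sup>2"
    using bisect_power4_mod_4(2)[of A] bisect_power4_mod_4(1)[of B] square_mod_4[OF assms(2)]
    by (metis dvd_diff)
qed

text \<open>The determinant formed from the parts \<open>P\<^sup>2\<close> and
  \<open>- T\<^sup>2\<close> is again of the shape of the denominator, so the step can be
  iterated.\<close>

lemma odd_part_eliminate_mod_4:
  fixes A B P T C G :: "int fps"
  assumes "2 dvd A - P" "2 dvd B - T" "4 dvd (A ^ 4 - fps_X * B ^ 4) * C - G"
  shows "4 dvd (P ^ 4 - fps_X * T ^ 4) * odd_part C - (P\<^sup>2 * odd_part G + T\<^sup>2 * even_part G)"
proof -
  define F where "F = A ^ 4 - fps_X * B ^ 4"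
  obtain H where G: "F * C = G + 4 * H"
    using assms(3) unfolding F_def by (metis diff_eq_eq add.commute dvdE)
  obtain U where U: "even_part F = P\<^sup>2 + 4 * U"
    using bisect_denominator_mod_4(1)[OF assms(1,2)] unfolding F_def
    by (metis diff_eq_eq add.commute dvdE)
  obtain V where V: "odd_part F = - T\<^sup>2 + 4 * V"
    using bisect_denominator_mod_4(2)[OF assms(1,2)] unfolding F_def
    by (metis add_diff_cancel_right' add.commute dvdE uminus_add_conv_diff)
  \<comment> \<open>A quarter of all terms containing \<open>U\<close>, \<open>V\<close> or
    \<open>H\<close> once the exact elimination is expanded.\<close>
  let ?W = "P\<^sup>2 * odd_part H + T\<^sup>2 * even_part H
      + U * (odd_part G + 4 * odd_part H) - V * (even_part G + 4 * even_part H)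
      - (2 * P\<^sup>2 * U + 4 * U\<^sup>2 + fps_X * (2 * T\<^sup>2 * V - 4 * V\<^sup>2)) * odd_part C"
  have elim: "((P\<^sup>2 + 4 * U)\<^sup>2 - fps_X * (- T\<^sup>2 + 4 * V)\<^sup>2) * odd_part C
      = (P\<^sup>2 + 4 * U) * (odd_part G + 4 * odd_part H)
        - (- T\<^sup>2 + 4 * V) * (even_part G + 4 * even_part H)" (is "?l = ?r")
    using odd_part_eliminate[OF G] unfolding U V by simp
  have "(P ^ 4 - fps_X * T ^ 4) * odd_part C - (P\<^sup>2 * odd_part G + T\<^sup>2 * even_part G)
      = 4 * ?W + (?l - ?r)"
    by (simp add: algebra_simps power2_eq_square power4_eq_xxxx)
  also have "\<dots> = 4 * ?W" by (simp only: elim diff_self add_0_right)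
  finally show ?thesis by (rule dvdI)
qed

lemma unit_dvd_cancel_mod_4:
  fixes D W :: "int fps"
  assumes "4 dvd D * W" "D $ 0 = 1"
  shows "4 dvd W"
proof -
  have "fps_right_inverse D 1 * (D * W) = W"
    using fps_right_inverse[of D 1] assms(2) by (metis mult.assoc mult.commute mult_1 mult_1_right)
  then show ?thesis using assms(1) by (metis dvd_mult)
qed

subsection \<open>Theta series with signs\<close>

text \<open>A theta series with free weight, true or false depending on \<open>w\<close>: bisection
  then merely reindexes the weight. For the pairs 3, 1 and 3, 2 and their doubles the index sets are
  finite, so the convention for infinite sums never matters.\<close>

definition quad_series :: "(int \<Rightarrow> int) \<Rightarrow> int \<Rightarrow> int \<Rightarrow> int fps" where
  "quad_series w a b = Abs_fps (\<lambda>k. \<Sum>n | int k = a * n\<^sup>2 + b * n. w n)"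

text \<open>Signs are invisible modulo 2; this is how false theta series get replaced by ordinary
  ones.\<close>

lemma quad_series_odd_weight:
  assumes "\<And>n. odd (w n)"
  shows "2 dvd quad_series w a b - quad_series (\<lambda>_. 1) a b"
proof -
  have "even (\<Sum>n\<in>S. w n - 1)" for S :: "int set"
    using assms by (intro dvd_sum) auto
  then show ?thesis
    unfolding numeral_dvd_fps_iff
    by (simp add: quad_series_def sum_subtractf)
qed

lemma bisect_quad_series_double:
  "even_part (quad_series w (2 * a) (2 * b)) = quad_series w a b"
  "odd_part (quad_series w (2 * a) (2 * b)) = 0"
proof -
  have rhs: "2 * a * n\<^sup>2 + 2 * b * n = 2 * (a * n\<^sup>2 + b * n)" for n
    by (simp add: algebra_simps)
  have "int (2 * k) = 2 * a * n\<^sup>2 + 2 * b * n \<longleftrightarrow> int k = a * n\<^sup>2 + b * n" for k n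
    unfolding rhs by presburger
  then show "even_part (quad_series w (2 * a) (2 * b)) = quad_series w a b"
    by (simp only: quad_series_def fps_eq_iff even_part_nth fps_nth_Abs_fps simp_thms)
  have "int (Suc (2 * k)) \<noteq> 2 * a * n\<^sup>2 + 2 * b * n" for k n
    unfolding rhs by presburger
  then show "odd_part (quad_series w (2 * a) (2 * b)) = 0"
    unfolding fps_eq_iff odd_part_nth quad_series_def by simp
qed

lemma odd_part_quad_series_3_1: "odd_part (quad_series w 3 1) = 0"
proof -
  have "int (Suc (2 * k)) \<noteq> 3 * n\<^sup>2 + 1 * n" for k and n :: int
  proof
    assume "int (Suc (2 * k)) = 3 * n\<^sup>2 + 1 * n"
    then have "odd (3 * n\<^sup>2 + n)" by (metis even_Suc dvd_triv_left even_of_nat_iff mult_1)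
    then show False by simp
  qed
  then show ?thesis
    unfolding fps_eq_iff odd_part_nth quad_series_def by simp
qed

text \<open>The exponent has the parity of n. For odd n the substitution is n = -2m-1 rather than
  2m+1, because it yields 6m^2+4m, the double of the original form, so that the bisection can be
  repeated.\<close>

lemma bisect_quad_series_3_2:
  "even_part (quad_series w 3 2) = quad_series (\<lambda>m. w (2 * m)) 6 2"
  "odd_part (quad_series w 3 2) = quad_series (\<lambda>m. w (- 2 * m - 1)) 6 4"
proof -
  have par: "even (3 * n\<^sup>2 + 2 * n) \<longleftrightarrow> even n" for n :: int by simp
  show "even_part (quad_series w 3 2) = quad_series (\<lambda>m. w (2 * m)) 6 2"
  proof (rule fps_ext)
    fix k
    have "(\<Sum>n | int (2 * k) = 3 * n\<^sup>2 + 2 * n. w n)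
        = (\<Sum>m | int k = 6 * m\<^sup>2 + 2 * m. w (2 * m))"
    proof (rule sum.reindex_bij_witness[of _ "\<lambda>m. 2 * m" "\<lambda>n. n div 2"])
      fix n assume "n \<in> {n. int (2 * k) = 3 * n\<^sup>2 + 2 * n}"
      then have n: "int (2 * k) = 3 * n\<^sup>2 + 2 * n" by simp
      then have "even n" using par[of n] by (metis dvd_triv_left even_of_nat_iff)
      then obtain m where m: "n = 2 * m" by blast
      show "2 * (n div 2) = n" "w (2 * (n div 2)) = w n" using m by simp_all
      show "n div 2 \<in> {m. int k = 6 * m\<^sup>2 + 2 * m}" using n m by (simp add: power2_eq_square)
    qed (auto simp: power2_eq_square)
    then show "even_part (quad_series w 3 2) $ k = quad_series (\<lambda>m. w (2 * m)) 6 2 $ k"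
      by (simp add: quad_series_def)
  qed
  show "odd_part (quad_series w 3 2) = quad_series (\<lambda>m. w (- 2 * m - 1)) 6 4"
  proof (rule fps_ext)
    fix k
    have "(\<Sum>n | int (Suc (2 * k)) = 3 * n\<^sup>2 + 2 * n. w n)
        = (\<Sum>m | int k = 6 * m\<^sup>2 + 4 * m. w (- 2 * m - 1))"
    proof (rule sum.reindex_bij_witness[of _ "\<lambda>m. - 2 * m - 1" "\<lambda>n. (- n - 1) div 2"])
      fix n assume "n \<in> {n. int (Suc (2 * k)) = 3 * n\<^sup>2 + 2 * n}"
      then have n: "int (Suc (2 * k)) = 3 * n\<^sup>2 + 2 * n" by simp
      then have "odd n" using par[of n] by (metis dvd_triv_left even_Suc even_of_nat_iff)
      then have "even (- n - 1)" by simp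
      then obtain l where "- n - 1 = 2 * l" by blast
      then have l: "n = - 2 * l - 1" by simp
      show "- 2 * ((- n - 1) div 2) - 1 = n" "w (- 2 * ((- n - 1) div 2) - 1) = w n"
        using l by simp_all
      have "int k = 6 * l\<^sup>2 + 4 * l"
        using n unfolding l by (simp add: power2_eq_square algebra_simps)
      then show "(- n - 1) div 2 \<in> {m. int k = 6 * m\<^sup>2 + 4 * m}"
        using l by simp
    qed (auto simp: power2_eq_square algebra_simps)
    then show "odd_part (quad_series w 3 2) $ k = quad_series (\<lambda>m. w (- 2 * m - 1)) 6 4 $ k"
      by (simp add: quad_series_def)
  qed
qed

lemma quad_series_3_1_nth_0: "quad_series w 3 1 $ 0 = w 0"
proof -
  have "0 = 3 * n\<^sup>2 + n \<longleftrightarrow> n = 0" for n :: int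
  proof
    assume "0 = 3 * n\<^sup>2 + n"
    then have "n * (3 * n + 1) = 0" by (simp add: power2_eq_square algebra_simps)
    then show "n = 0" by (auto; presburger)
  qed simp
  then show ?thesis by (simp add: quad_series_def)
qed

text \<open>Combines the minus sign before the sum over negative n with the sign of the power of
  -q^5, so that one sum over all integers remains.\<close>

definition false_theta_sign :: "int \<Rightarrow> int" where
  "false_theta_sign n = (if n \<ge> 0 then 1 else - 1) * (- 1) ^ nat (n * (n + 1) div 2)"

lemma odd_false_theta_sign: "odd (false_theta_sign n)"
  by (simp add: false_theta_sign_def)

lemma false_theta_eq_quad_series:
  "false_theta (- (fps_X ^ 5)) fps_X = quad_series false_theta_sign 3 2"
proof (rule fps_ext)
  fix k :: nat
  let ?S = "\<lambda>A. {n. n \<in> A \<and> int k = 3 * n\<^sup>2 + 2 * n}"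
  let ?e = "\<lambda>n::int. (- 1) ^ nat (n * (n + 1) div 2) :: int"
  have fin: "finite (?S A)" for A
  proof (rule finite_subset)
    have "\<bar>n\<bar> \<le> int k" if "n \<in> ?S A" for n
      using abs_le_exponent[of n] that by simp
    then show "?S A \<subseteq> {- int k..int k}" by (force simp: abs_le_iff)
  qed simp
  have "sum false_theta_sign {n. int k = 3 * n\<^sup>2 + 2 * n}
      = sum false_theta_sign (?S {0..} \<union> ?S {..-1})"
    by (rule arg_cong[of _ _ "sum _"]) auto
  also have "\<dots> = sum false_theta_sign (?S {0..}) + sum false_theta_sign (?S {..-1})"
    by (rule sum.union_disjoint[OF fin fin]) auto
  also have "sum false_theta_sign (?S {0..}) = sum ?e (?S {0..})"
    by (rule sum.cong) (auto simp: false_theta_sign_def)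
  also have "sum false_theta_sign (?S {..-1}) = - sum ?e (?S {..-1})"
    unfolding sum_negf[symmetric] by (rule sum.cong) (auto simp: false_theta_sign_def)
  finally show "false_theta (- (fps_X ^ 5)) fps_X $ k = quad_series false_theta_sign 3 2 $ k"
    unfolding false_theta_def
    by (subst (1 2) infsumI[OF false_theta_has_sum]) (simp add: quad_series_def)
qed

subsection \<open>The congruence modulo 4\<close>

text \<open>Modulo 4 the squares of \<open>a\<close> and \<open>b\<close> equal those of
  \<open>P\<close> and \<open>T\<close>, so the two terms add up to
  \<open>4 * P\<^sup>2 * T\<^sup>2 * b\<close>.\<close>

lemma cubic_cancel_mod_4:
  fixes a b P T :: "int fps"
  assumes "2 dvd a - P" "2 dvd b - T"
  shows "4 dvd P\<^sup>2 * b ^ 3 + 3 * T\<^sup>2 * a\<^sup>2 * b"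
proof -
  obtain p where p: "a = P + 2 * p"
    using assms(1) by (metis diff_eq_eq add.commute dvdE)
  obtain t where t: "b = T + 2 * t"
    using assms(2) by (metis diff_eq_eq add.commute dvdE)
  have "P\<^sup>2 * b ^ 3 + 3 * T\<^sup>2 * a\<^sup>2 * b
      = 4 * (P\<^sup>2 * (T\<^sup>2 * b + T * t * b + t\<^sup>2 * b) + 3 * T\<^sup>2 * (P * p + p\<^sup>2) * b)"
    unfolding p t by (simp add: power2_eq_square power3_eq_cube algebra_simps)
  then show ?thesis by (rule dvdI)
qed

theorem theorem2:
  fixes n :: nat
  shows "[c5 (32 * n + 31) = 0] (mod 4)"
proof -
  define C where "C = Abs_fps c5"
  define w where "w = false_theta_sign"
  define A where "A = quad_series (\<lambda>m. w (2 * m)) 3 1"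
  define wB where "wB = (\<lambda>m. w (- 2 * m - 1))"
  define B where "B = quad_series wB 3 2"
  define \<alpha> where "\<alpha> = quad_series (\<lambda>m. wB (2 * m)) 6 2"
  define \<beta> where "\<beta> = quad_series (\<lambda>m. wB (- 2 * m - 1)) 6 4"
  define a where "a = quad_series (\<lambda>m. wB (2 * m)) 3 1"
  define b where "b = quad_series (\<lambda>m. wB (- 2 * m - 1)) 3 2"
  define P where "P = quad_series (\<lambda>_. 1) 3 1"
  define T where "T = quad_series (\<lambda>_. 1) 3 2"
  define R where "R = even_part P"
  define Y where "Y = even_part T"
  define Z where "Z = odd_part T"
  define D where "D = P ^ 4 - fps_X * T ^ 4"
  have odd_w: "odd (w m)" "odd (wB m)" for m
    by (simp_all add: w_def wB_def odd_false_theta_sign)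
  have mod2: "2 dvd A - P" "2 dvd B - T" "2 dvd a - P" "2 dvd b - T" "2 dvd P - P" "2 dvd T - T"
    unfolding A_def B_def a_def b_def P_def T_def
    by (intro quad_series_odd_weight odd_w; simp)+

  have F0: "quad_series w 3 2 * C = 1"
    unfolding w_def C_def false_theta_eq_quad_series[symmetric] by (rule false_theta_mult_c5)
  \<comment> \<open>The even and odd parts of the false theta function, which are A(q^2) and
    B(q^2).\<close>
  define A2 where "A2 = quad_series (\<lambda>m. w (2 * m)) 6 2"
  define B2 where "B2 = quad_series wB 6 4"
  have A2: "even_part A2 = A" "odd_part A2 = 0" and B2: "even_part B2 = B" "odd_part B2 = 0"
    using bisect_quad_series_double[of _ 3 1] bisect_quad_series_double[of _ 3 2]
    by (simp_all add: A2_def B2_def A_def B_def)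
  have F1: "(A2\<^sup>2 - fps_X * B2\<^sup>2) * odd_part C = - B2"
    using odd_part_eliminate[OF F0] unfolding bisect_quad_series_3_2 A2_def B2_def wB_def by simp
  \<comment> \<open>The denominator in \<open>F1\<close> has parts \<open>A\<^sup>2\<close> and
    \<open>- B\<^sup>2\<close>, and \<open>- B2\<close> has only an even part. Up to here everything
    is exact over the integers.\<close>
  have F2: "(A ^ 4 - fps_X * B ^ 4) * odd_part (odd_part C) = - (B ^ 3)"
    using odd_part_eliminate[OF F1]
    by (simp add: A2 B2 power2_eq_square power3_eq_cube power4_eq_xxxx mult.assoc)

  have ab: "even_part \<alpha> = a" "odd_part \<alpha> = 0" "even_part \<beta> = b" "odd_part \<beta> = 0"
    using bisect_quad_series_double[of _ 3 1] bisect_quad_series_double[of _ 3 2]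
    by (simp_all add: \<alpha>_def \<beta>_def a_def b_def)
  have B: "even_part B = \<alpha>" "odd_part B = \<beta>"
    unfolding B_def bisect_quad_series_3_2 by (simp_all add: \<alpha>_def \<beta>_def)
  have P: "even_part P = R" "odd_part P = 0"
    by (simp_all add: R_def P_def odd_part_quad_series_3_1)
  have YZ: "odd_part Y = 0" "odd_part Z = 0"
    using bisect_quad_series_double(2)[of _ 3 1] bisect_quad_series_double(2)[of _ 3 2]
    by (simp_all add: Y_def Z_def T_def bisect_quad_series_3_2)
  \<comment> \<open>The brackets are the odd and even parts of the cube of \<open>B\<close>, whose
    own parts are \<open>\<alpha>\<close> and \<open>\<beta>\<close>.\<close>
  define G3 where
    "G3 = - (P\<^sup>2 * (3 * \<alpha>\<^sup>2 * \<beta> + fps_X * \<beta> ^ 3) + T\<^sup>2 * (\<alpha> ^ 3 + 3 * (fps_X * (\<alpha> * \<beta>\<^sup>2))))"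
  have F3: "4 dvd D * odd_part (odd_part (odd_part C)) - G3"
  proof -
    have "P\<^sup>2 * odd_part (- (B ^ 3)) + T\<^sup>2 * even_part (- (B ^ 3)) = G3"
      by (simp add: G3_def B power3_eq_cube power2_eq_square algebra_simps)
    then show ?thesis
      using odd_part_eliminate_mod_4[OF mod2(1,2), of "odd_part (odd_part C)" "- (B ^ 3)"] F2
      unfolding D_def by simp
  qed
  define C4 where "C4 = odd_part (odd_part (odd_part (odd_part C)))"
  \<comment> \<open>The denominator is now \<open>D\<close> itself, so the same lemma applies with
    \<open>A = P\<close> and \<open>B = T\<close>.\<close>
  have F4: "4 dvd D * C4 - (P\<^sup>2 * odd_part G3 + T\<^sup>2 * even_part G3)"
    using odd_part_eliminate_mod_4[OF mod2(5,6) F3[unfolded D_def]]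
    unfolding D_def C4_def .

  define U where "U = Y\<^sup>2 + fps_X * Z\<^sup>2"
  have T2: "even_part (T\<^sup>2) = U" "odd_part (T\<^sup>2) = 2 * (Y * Z)"
    by (simp_all add: power2_eq_square U_def Y_def Z_def algebra_simps)
  have G3e: "even_part G3 = - (R\<^sup>2 * (3 * a\<^sup>2 * b) + U * a ^ 3 + 6 * fps_X * Y * Z * a * b\<^sup>2)"
    unfolding G3_def bisect_linear bisect_mult T2
    by (simp add: ab P power2_eq_square power3_eq_cube algebra_simps)
  have G3o: "odd_part G3 = - (R\<^sup>2 * b ^ 3 + U * (3 * a * b\<^sup>2) + 2 * Y * Z * a ^ 3)"
    unfolding G3_def bisect_linear bisect_mult T2
    by (simp add: ab P power2_eq_square power3_eq_cube algebra_simps)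

  \<comment> \<open>The terms with factor \<open>R\<^sup>2\<close> or \<open>U\<close> vanish by
    \<open>cubic_cancel_mod_4\<close>, used once with the roles of the pairs swapped. The rest
    carries a factor 2, so \<open>a\<close> and \<open>b\<close> may be read as \<open>P\<close> and
    \<open>T\<close> modulo 2, which turns its cofactor into \<open>D * (P * Y * Z)\<close>.\<close>
  have "4 dvd D * (2 * (P * Y * Z)) - (P\<^sup>2 * odd_part G3 + T\<^sup>2 * even_part G3)"
  proof -
    obtain p where p: "a = P + 2 * p" using mod2(3) by (metis diff_eq_eq add.commute dvdE)
    obtain t where t: "b = T + 2 * t" using mod2(4) by (metis diff_eq_eq add.commute dvdE)
    have "D * (P * Y * Z) + Y * Z * (P\<^sup>2 * a ^ 3 + 3 * fps_X * T\<^sup>2 * a * b\<^sup>2)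
        = 2 * (Y * Z * (P ^ 4 * P + fps_X * P * T ^ 4
            + P\<^sup>2 * p * (3 * P\<^sup>2 + 6 * P * p + 4 * p\<^sup>2)
            + 3 * fps_X * T\<^sup>2 * (p * T\<^sup>2 + 2 * a * t * (T + t))))"
      unfolding D_def p t
      by (simp add: power2_eq_square power3_eq_cube power4_eq_xxxx algebra_simps)
    then have "2 dvd D * (P * Y * Z) + Y * Z * (P\<^sup>2 * a ^ 3 + 3 * fps_X * T\<^sup>2 * a * b\<^sup>2)"
      by simp
    then have "2 * 2 dvd 2 * (D * (P * Y * Z) + Y * Z * (P\<^sup>2 * a ^ 3 + 3 * fps_X * T\<^sup>2 * a * b\<^sup>2))"
      by (rule mult_dvd_mono[OF dvd_refl])
    then have "4 dvd 2 * (D * (P * Y * Z) + Y * Z * (P\<^sup>2 * a ^ 3 + 3 * fps_X * T\<^sup>2 * a * b\<^sup>2))"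
      by simp
    moreover have "D * (2 * (P * Y * Z)) - (P\<^sup>2 * odd_part G3 + T\<^sup>2 * even_part G3)
        = 2 * (D * (P * Y * Z) + Y * Z * (P\<^sup>2 * a ^ 3 + 3 * fps_X * T\<^sup>2 * a * b\<^sup>2))
          + R\<^sup>2 * (P\<^sup>2 * b ^ 3 + 3 * T\<^sup>2 * a\<^sup>2 * b) + U * (T\<^sup>2 * a ^ 3 + 3 * P\<^sup>2 * b\<^sup>2 * a)"
      unfolding G3e G3o
      by (simp add: power2_eq_square power3_eq_cube power4_eq_xxxx algebra_simps)
    ultimately show ?thesis
      using cubic_cancel_mod_4[OF mod2(3,4)] cubic_cancel_mod_4[OF mod2(4,3)]
      by (metis dvd_add dvd_mult)
  qed
  with F4 have "4 dvd D * (C4 - 2 * (P * Y * Z))"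
    by (metis (no_types, lifting) dvd_diff diff_diff_eq2 diff_add_cancel right_diff_distrib)
  moreover have "D $ 0 = 1"
    by (simp add: D_def P_def quad_series_3_1_nth_0 power4_eq_xxxx)
  ultimately have "4 dvd C4 - 2 * (P * Y * Z)"
    by (rule unit_dvd_cancel_mod_4)
  \<comment> \<open>A fifth bisection finishes: \<open>P\<close>, \<open>Y\<close> and
    \<open>Z\<close> are series in q^2, hence so is their product.\<close>
  then have "4 dvd odd_part (C4 - 2 * (P * Y * Z))"
    by (rule bisect_numeral_dvd)
  then have "4 dvd odd_part C4" by (simp add: P YZ)
  then have "4 dvd odd_part C4 $ n" unfolding numeral_dvd_fps_iff by blast
  \<comment> \<open>Iterating k -> 2k+1 five times from n gives 32n+31.\<close>
  moreover have "odd_part C4 $ n = c5 (32 * n + 31)"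
    by (auto simp: C4_def C_def intro!: arg_cong[of _ _ c5])
  ultimately show ?thesis by (simp add: cong_0_iff)
qed

end
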